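(* Let $K_1,\dots,K_r\subset\mathbb{R}^n$ be closed convex sets with $K:=\bigcap_{l=1}^rK_l\neq\emptyset$, let $x_0\in\mathbb{R}^n$, and let $\bar x=P_K(x_0)$. Suppose that for some $\bar\epsilon>0$, $$[K_j-\bar x]\cap\bar\epsilon\mathbb{B}=T_{K_j}(\bar x)\cap\bar\epsilon\mathbb{B}\quad\text{for } j=1,\dots,r,$$ and that $$x_0-\bar x\in\operatorname{int}\big(N_K(\bar x)\big).$$ Then the best approximation algorithm (described in the context) started at $x_0$ with the choice $J_i=\{1,\dots,r\}$ for all $i$ converges to $\bar x$ in finitely many iterations, i.e. $x_i=\bar x$ for some $i$.
   Context: $P_C$ denotes the metric projection onto a nonempty closed convex set $C$; $\mathbb{B}$ is the closed unit ball of $\mathbb{R}^n$; $T_C(\bar x)$ and $N_C(\bar x)$ are the tangent cone and normal cone (in the sense of convex analysis) of a convex set $C$ at $\bar x\in C$. Best approximation algorithm with $J_i=\{1,\dots,r\}$: given $x_0\in \mathbb{R}^n$, for $i=1,2,\dots$ and each $j\in\{1,\dots,r\}$ set $$x_i^{(j)}=P_{K_j}(x_{i-1}),\quad a_i^{(j)}=x_{i-1}-x_i^{(j)},\quad b_i^{(j)}=\langle a_i^{(j)},x_i^{(j)}\rangle;$$ define $$F_i:=\{x\in \mathbb{R}^n\mid \langle a_l^{(j)},x\rangle\leq b_l^{(j)}\text{ for all } l=1,\dots,i\text{ and } j=1,\dots,r\},$$ and set $x_i=P_{F_i}(x_0)$ (the projection of the original starting point $x_0$). *)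

theory Defs
  imports "HOL-Analysis.Analysis"
begin

text \<open>
  The metric projection \<open>P\<^sub>C(x)\<close> is the library's \<^const>\<open>closest_point\<close> \<open>C x\<close>, which is the unique
  nearest point whenever \<open>C\<close> is nonempty, closed and convex.
\<close>

text \<open>
  Both cones are meant for convex \<open>C\<close> and \<open>x \<in> C\<close>; for other arguments the values carry no meaning.
  The tangent cone of convex analysis is the closure of the cone of feasible directions.
\<close>

definition tangent_cone :: "'a::euclidean_space set \<Rightarrow> 'a \<Rightarrow> 'a set" where
  "tangent_cone C x = closure (cone hull ((\<lambda>y. y - x) ` C))"

definition normal_cone :: "'a::euclidean_space set \<Rightarrow> 'a \<Rightarrow> 'a set" where
  "normal_cone C x = {v. \<forall>y\<in>C. v \<bullet> (y - x) \<le> 0}"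

text \<open>
  In the following, \<open>x\<close> is the sequence of iterates and \<open>K j\<close> with \<open>j \<in> {1..r}\<close> are the given sets.
  The points, normals and right-hand sides of step \<open>i\<close> are indexed by \<open>i \<ge> 1\<close> and built from
  \<open>x (i - 1)\<close>; step 0 is never used.
\<close>

definition proj_point :: "(nat \<Rightarrow> 'a::euclidean_space set) \<Rightarrow> (nat \<Rightarrow> 'a) \<Rightarrow> nat \<Rightarrow> nat \<Rightarrow> 'a" where
  "proj_point K x i j = closest_point (K j) (x (i - 1))"

definition cut_normal :: "(nat \<Rightarrow> 'a::euclidean_space set) \<Rightarrow> (nat \<Rightarrow> 'a) \<Rightarrow> nat \<Rightarrow> nat \<Rightarrow> 'a" where
  "cut_normal K x i j = x (i - 1) - proj_point K x i j"

definition cut_rhs :: "(nat \<Rightarrow> 'a::euclidean_space set) \<Rightarrow> (nat \<Rightarrow> 'a) \<Rightarrow> nat \<Rightarrow> nat \<Rightarrow> real" where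
  "cut_rhs K x i j = cut_normal K x i j \<bullet> proj_point K x i j"

definition outer_polyhedron ::
    "(nat \<Rightarrow> 'a::euclidean_space set) \<Rightarrow> nat \<Rightarrow> (nat \<Rightarrow> 'a) \<Rightarrow> nat \<Rightarrow> 'a set" where
  "outer_polyhedron K r x i =
     {y. \<forall>l\<in>{1..i}. \<forall>j\<in>{1..r}. cut_normal K x l j \<bullet> y \<le> cut_rhs K x l j}"

definition best_approx_iterates ::
    "(nat \<Rightarrow> 'a::euclidean_space set) \<Rightarrow> nat \<Rightarrow> 'a \<Rightarrow> (nat \<Rightarrow> 'a) \<Rightarrow> bool" where
  "best_approx_iterates K r x0 x \<longleftrightarrow>
     x 0 = x0 \<and> (\<forall>i\<ge>1. x i = closest_point (outer_polyhedron K r x i) x0)"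

text \<open>
  The recursion determines the iterates, since \<open>outer_polyhedron K r x i\<close> depends only on
  \<open>x 0, \<dots>, x (i - 1)\<close>.
\<close>

lemma outer_polyhedron_cong:
  assumes "\<And>k. k < i \<Longrightarrow> x k = y k"
  shows "outer_polyhedron K r x i = outer_polyhedron K r y i"
proof -
  have "x (l - 1) = y (l - 1)" if "l \<in> {1..i}" for l
    using that by (intro assms) auto
  then show ?thesis
    by (auto simp: outer_polyhedron_def cut_normal_def cut_rhs_def proj_point_def)
qed

lemma best_approx_iterates_ex1: "\<exists>!x. best_approx_iterates K r x0 x"
proof (rule ex_ex1I)
  define P where
    "P f i z \<longleftrightarrow> z = (if i = 0 then x0 else closest_point (outer_polyhedron K r f i) x0)" for f i z
  have "\<exists>f. \<forall>i. P f i (f i)"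
  proof (rule dependent_wellorder_choice)
    show "P f i z = P g i z" if "\<And>k. k < i \<Longrightarrow> f k = g k" for z f g i
      unfolding P_def using outer_polyhedron_cong[OF that] by simp
  qed (simp add: P_def)
  then obtain f where "\<And>i. P f i (f i)" by blast
  then have "best_approx_iterates K r x0 f"
    unfolding best_approx_iterates_def P_def by (metis not_one_le_zero)
  then show "\<exists>x. best_approx_iterates K r x0 x" by blast
next
  fix x y
  assume xy: "best_approx_iterates K r x0 x" "best_approx_iterates K r x0 y"
  have "x i = y i" for i
  proof (induction i rule: less_induct)
    case (less i)
    show ?case
    proof (cases "i = 0")
      case True
      then show ?thesis using xy by (simp add: best_approx_iterates_def)
    next
      case False
      then show ?thesis
        using xy outer_polyhedron_cong[of i x y K r] less
        by (simp add: best_approx_iterates_def)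
    qed
  qed
  then show "x = y" by blast
qed

end

theory Submission
  imports Defs
begin

text \<open>
  Suppose that no iterate equals \<open>xbar\<close>. Every cut of the algorithm contains \<open>K\<close>, so all iterates
  stay within distance \<open>dist x0 xbar\<close> of \<open>x0\<close>, and a convergent subsequence exists. As the cut made
  at \<open>x i\<close> for \<open>K j\<close> is at depth \<open>dist (x i) (closest_point (K j) (x i))\<close> and is respected by all
  later iterates, these depths tend to \<open>0\<close> along the subsequence; the limit lies in \<open>K\<close>, no farther from \<open>x0\<close> than \<open>xbar\<close>,
  and hence is \<open>xbar\<close> (\<open>iterates_cluster_at_projection\<close>).

  Refine the subsequence so that the directions \<open>d i = (x i - xbar) / norm (x i - xbar)\<close> converge,
  to \<open>d\<close> say. Near \<open>xbar\<close> projecting onto \<open>K j\<close> amounts to projecting onto its tangent cone \<open>T\<close>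
  (\<open>closest_point_locally_conic\<close>). Consequently the hyperplanes of the late cuts pass through \<open>xbar\<close>,
  and the cut made at \<open>x i\<close> has normal direction \<open>d i - P\<^sub>T (d i)\<close>. Later iterates respect this cut,
  so \<open>(d i - P\<^sub>T (d i)) \<bullet> d \<le> 0\<close>; letting \<open>i\<close> tend to infinity, \<open>(d - P\<^sub>T d) \<bullet> d \<le> 0\<close>. The left-hand
  side is the squared distance from \<open>d\<close> to \<open>T\<close>, so \<open>d \<in> T\<close>, for every \<open>j\<close>. By local conicity \<open>K\<close>
  contains \<open>xbar + eps *\<^sub>R d\<close>, and the interior normal condition then makes \<open>(x0 - xbar) \<bullet> d\<close> negative.
  But \<open>x i\<close> is the projection of \<open>x0\<close> onto a set containing \<open>xbar\<close>, which forces
  \<open>(x0 - x i) \<bullet> d i \<ge> 0\<close> and in the limit \<open>(x0 - xbar) \<bullet> d \<ge> 0\<close>, a contradiction.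
\<close>

section \<open>Normal and tangent cones\<close>

text \<open>
  An interior normal \<open>v\<close> may be tilted slightly towards \<open>y - x\<close> and remains normal, which leaves room
  for a strict inequality.
\<close>

lemma interior_normal_cone_dot_less:
  assumes "v \<in> interior (normal_cone C x)" "y \<in> C" "y \<noteq> x"
  shows "v \<bullet> (y - x) < 0"
proof -
  obtain e where e: "e > 0" "cball v e \<subseteq> normal_cone C x"
    using assms(1) mem_interior_cball by blast
  define t where "t = e / norm (y - x)"
  have "t > 0" using e assms(3) by (simp add: t_def)
  have "v + t *\<^sub>R (y - x) \<in> cball v e"
    using e assms(3) by (simp add: dist_norm t_def)
  then have "(v + t *\<^sub>R (y - x)) \<bullet> (y - x) \<le> 0"
    using e assms(2) by (auto simp: normal_cone_def)
  then have "v \<bullet> (y - x) + t * ((y - x) \<bullet> (y - x)) \<le> 0"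
    by (simp add: inner_add_left)
  moreover have "t * ((y - x) \<bullet> (y - x)) > 0"
    using \<open>t > 0\<close> assms(3) by simp
  ultimately show ?thesis by linarith
qed

lemma closed_tangent_cone: "closed (tangent_cone C x)"
  by (simp add: tangent_cone_def)

lemma convex_tangent_cone: "convex C \<Longrightarrow> convex (tangent_cone C x)"
  unfolding tangent_cone_def
  by (intro convex_closure convex_cone_hull convex_translation_subtract)

lemma cone_tangent_cone: "cone (tangent_cone C x)"
  unfolding tangent_cone_def by (intro cone_closure cone_cone_hull)

lemma diff_in_tangent_cone: "y \<in> C \<Longrightarrow> y - x \<in> tangent_cone C x"
  unfolding tangent_cone_def by (meson closure_subset hull_subset image_eqI subsetD)

section \<open>Projection onto a cone\<close>

lemma closest_point_cone_scaleR:
  fixes T :: "'a::euclidean_space set"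
  assumes T: "closed T" "convex T" "cone T" "T \<noteq> {}" and "c > 0"
  shows "closest_point T (c *\<^sub>R v) = c *\<^sub>R closest_point T v"
proof (rule closest_point_unique[OF T(2,1), symmetric])
  have scale: "dist (c *\<^sub>R u) (c *\<^sub>R w) = c * dist u w" for u w :: 'a
    using \<open>c > 0\<close> by (simp add: dist_norm flip: scaleR_diff_right)
  show "c *\<^sub>R closest_point T v \<in> T"
    using assms by (intro mem_cone closest_point_in_set) auto
  show "\<forall>z\<in>T. dist (c *\<^sub>R v) (c *\<^sub>R closest_point T v) \<le> dist (c *\<^sub>R v) z"
  proof
    fix z assume "z \<in> T"
    then have "inverse c *\<^sub>R z \<in> T" using assms by (intro mem_cone) auto
    then have "dist v (closest_point T v) \<le> dist v (inverse c *\<^sub>R z)"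
      using closest_point_le T by blast
    then have "c * dist v (closest_point T v) \<le> c * dist v (inverse c *\<^sub>R z)"
      using \<open>c > 0\<close> by simp
    then show "dist (c *\<^sub>R v) (c *\<^sub>R closest_point T v) \<le> dist (c *\<^sub>R v) z"
      using \<open>c > 0\<close> unfolding scale[symmetric] by simp
  qed
qed

text \<open>
  The residual makes an obtuse angle with every feasible direction at the projection, and on the ray
  of the cone through the projection both directions are feasible: moving to \<open>0\<close> and to its double.
\<close>

lemma closest_point_cone_orthogonal:
  assumes T: "closed T" "convex T" "cone T" "T \<noteq> {}"
  shows "(v - closest_point T v) \<bullet> closest_point T v = 0"
proof -
  define p where "p = closest_point T v"
  have p: "p \<in> T" unfolding p_def using T by (intro closest_point_in_set)
  have "0 *\<^sub>R p \<in> T" "2 *\<^sub>R p \<in> T"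
    using p T(3) by (auto intro!: mem_cone simp del: scaleR_zero_left)
  then have "(v - p) \<bullet> (0 *\<^sub>R p - p) \<le> 0" "(v - p) \<bullet> (2 *\<^sub>R p - p) \<le> 0"
    unfolding p_def using closest_point_dot T by blast+
  then have "(v - p) \<bullet> p \<ge> 0" "(v - p) \<bullet> p \<le> 0"
    by (simp_all add: scaleR_2)
  then show ?thesis by (simp add: p_def)
qed

text \<open>
  The projection of \<open>z - a\<close> onto the tangent cone is no longer than \<open>z - a\<close>, so it stays in the ball
  on which \<open>C - a\<close> and the cone agree; and it beats all of \<open>C - a\<close>, a subset of the cone.
\<close>

lemma closest_point_locally_conic:
  assumes C: "closed C" "convex C" "a \<in> C"
    and conic: "(\<lambda>y. y - a) ` C \<inter> cball 0 eps = tangent_cone C a \<inter> cball 0 eps"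
    and z: "norm (z - a) \<le> eps"
  shows "closest_point C z = a + closest_point (tangent_cone C a) (z - a)"
proof -
  define T where "T = tangent_cone C a"
  have T: "closed T" "convex T" "0 \<in> T"
    using C closed_tangent_cone convex_tangent_cone diff_in_tangent_cone[of a C a]
    by (auto simp: T_def)
  define p where "p = closest_point T (z - a)"
  have p: "p \<in> T" unfolding p_def using T by (intro closest_point_in_set) auto
  have "dist (closest_point T (z - a)) (closest_point T 0) \<le> dist (z - a) 0"
    using T by (intro closest_point_lipschitz) auto
  then have "norm p \<le> norm (z - a)"
    using closest_point_self[OF T(3)] by (simp add: p_def)
  then have "p \<in> T \<inter> cball 0 eps" using p z by simp
  then have "p \<in> (\<lambda>y. y - a) ` C" using conic by (auto simp: T_def)
  then have "a + p \<in> C" by auto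
  moreover have "dist z (a + p) \<le> dist z y" if "y \<in> C" for y
  proof -
    have "dist (z - a) p \<le> dist (z - a) (y - a)"
      unfolding p_def using diff_in_tangent_cone[OF that, of a] T
      by (intro closest_point_le) (auto simp: T_def)
    then show ?thesis by (simp add: dist_norm algebra_simps)
  qed
  ultimately have "a + p = closest_point C z"
    using C by (intro closest_point_unique) auto
  then show ?thesis by (simp add: p_def T_def)
qed

section \<open>The iterates\<close>

lemma closed_outer_polyhedron: "closed (outer_polyhedron K r x i)"
proof -
  have "outer_polyhedron K r x i =
    (\<Inter>l\<in>{1..i}. \<Inter>j\<in>{1..r}. {y. cut_normal K x l j \<bullet> y \<le> cut_rhs K x l j})"
    by (auto simp: outer_polyhedron_def)
  then show ?thesis by (auto intro!: closed_INT closed_halfspace_le)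
qed

lemma convex_outer_polyhedron: "convex (outer_polyhedron K r x i)"
proof -
  have "outer_polyhedron K r x i =
    (\<Inter>l\<in>{1..i}. \<Inter>j\<in>{1..r}. {y. cut_normal K x l j \<bullet> y \<le> cut_rhs K x l j})"
    by (auto simp: outer_polyhedron_def)
  then show ?thesis by (auto intro!: convex_INT convex_halfspace_le)
qed

text \<open>The obtuse-angle characterization of projections says that \<open>K j\<close> is on the kept side of its cuts.\<close>

lemma Inter_subset_outer_polyhedron:
  assumes "\<And>j. j \<in> {1..r} \<Longrightarrow> closed (K j)" "\<And>j. j \<in> {1..r} \<Longrightarrow> convex (K j)"
  shows "(\<Inter>j\<in>{1..r}. K j) \<subseteq> outer_polyhedron K r x i"
proof
  fix y assume y: "y \<in> (\<Inter>j\<in>{1..r}. K j)"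
  have "cut_normal K x l j \<bullet> y \<le> cut_rhs K x l j" if "j \<in> {1..r}" for l j
  proof -
    have "(x (l - 1) - closest_point (K j) (x (l - 1)))
        \<bullet> (y - closest_point (K j) (x (l - 1))) \<le> 0"
      using y that assms by (intro closest_point_dot) auto
    then show ?thesis
      by (simp add: cut_rhs_def cut_normal_def proj_point_def inner_diff_right)
  qed
  then show "y \<in> outer_polyhedron K r x i"
    by (simp add: outer_polyhedron_def)
qed

text \<open>Step \<open>0\<close> is not exceptional: without cuts the polyhedron is the whole space.\<close>

lemma iterate_eq_closest_point:
  assumes "best_approx_iterates K r x0 x"
  shows "x i = closest_point (outer_polyhedron K r x i) x0"
proof (cases "i = 0")
  case True
  have "x0 \<in> outer_polyhedron K r x 0" by (simp add: outer_polyhedron_def)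
  then show ?thesis
    using assms True closest_point_self[of x0] by (simp add: best_approx_iterates_def)
next
  case False
  then show ?thesis using assms by (simp add: best_approx_iterates_def)
qed

lemma iterate_satisfies_earlier_cuts:
  assumes it: "best_approx_iterates K r x0 x" and "outer_polyhedron K r x m \<noteq> {}"
    and "i < m" "j \<in> {1..r}"
  shows "(x i - closest_point (K j) (x i)) \<bullet> (x m - closest_point (K j) (x i)) \<le> 0"
proof -
  have "x m \<in> outer_polyhedron K r x m"
    by (subst iterate_eq_closest_point[OF it])
      (intro closest_point_in_set closed_outer_polyhedron assms(2))
  then have "cut_normal K x (Suc i) j \<bullet> x m \<le> cut_rhs K x (Suc i) j"
    using assms(3,4) by (auto simp: outer_polyhedron_def)
  then show ?thesis
    by (simp add: cut_rhs_def cut_normal_def proj_point_def inner_diff_right)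
qed

text \<open>
  If \<open>x i\<close> is outside \<open>K j\<close>, the hyperplane through its projection separates it from all later
  iterates, and the distance of \<open>x i\<close> to this hyperplane is the distance to the projection.
\<close>

lemma cut_depth_le_dist_later_iterate:
  assumes "best_approx_iterates K r x0 x" and "outer_polyhedron K r x m \<noteq> {}"
    and "i < m" "j \<in> {1..r}"
  shows "norm (x i - closest_point (K j) (x i)) \<le> dist (x i) (x m)"
proof -
  define a where "a = x i - closest_point (K j) (x i)"
  have "norm a * norm a = a \<bullet> (x i - x m) + a \<bullet> (x m - closest_point (K j) (x i))"
    by (simp add: a_def flip: inner_add_right power2_norm_eq_inner power2_eq_square)
  also have "\<dots> \<le> norm a * dist (x i) (x m)"
    using iterate_satisfies_earlier_cuts[OF assms] norm_cauchy_schwarz[of a "x i - x m"]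
    by (simp add: a_def dist_norm)
  finally show ?thesis
    by (cases "a = 0") (auto simp: a_def)
qed

section \<open>Convergence to the projection\<close>

text \<open>
  Along a convergent subsequence successive iterates get close, hence so do the iterates and their
  projections; this places the limit in every \<open>K j\<close>. Among the points of the intersection only the
  projection of \<open>x0\<close> is as close to \<open>x0\<close> as the iterates are.
\<close>

lemma iterates_cluster_at_projection:
  assumes closed: "\<And>j. j \<in> {1..r} \<Longrightarrow> closed (K j)"
    and convex: "\<And>j. j \<in> {1..r} \<Longrightarrow> convex (K j)"
    and ne: "(\<Inter>j\<in>{1..r}. K j) \<noteq> {}"
    and it: "best_approx_iterates K r x0 x"
  obtains s where "strict_mono s" "(\<lambda>n. x (s n)) \<longlonglongrightarrow> closest_point (\<Inter>j\<in>{1..r}. K j) x0"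
proof -
  define C where "C = (\<Inter>j\<in>{1..r}. K j)"
  have C: "closed C" "convex C" "C \<noteq> {}"
    using closed convex ne by (auto simp: C_def intro!: convex_INT)
  have sub: "C \<subseteq> outer_polyhedron K r x i" for i
    unfolding C_def by (rule Inter_subset_outer_polyhedron[OF closed convex])
  then have F_ne: "outer_polyhedron K r x i \<noteq> {}" for i
    using C by blast
  have le: "dist x0 (x i) \<le> dist x0 y" if "y \<in> C" for i y
    using that sub by (subst iterate_eq_closest_point[OF it])
      (intro closest_point_le closed_outer_polyhedron, auto)
  define c where "c = closest_point C x0"
  have c: "c \<in> C" using C by (simp add: c_def closest_point_in_set)
  have "\<forall>n. x n \<in> cball x0 (dist x0 c)" using le[OF c] by simp
  then obtain L s where s: "strict_mono s" and lim: "(x \<circ> s) \<longlonglongrightarrow> L"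
    using compact_cball unfolding compact_def by meson
  have lim: "(\<lambda>n. x (s n)) \<longlonglongrightarrow> L" using lim by (simp add: o_def)
  have "(\<lambda>n. dist (x (s n)) (x (s (Suc n)))) \<longlonglongrightarrow> 0"
    using tendsto_dist[OF lim LIMSEQ_Suc[OF lim]] by simp
  then have "(\<lambda>n. x (s n) - closest_point (K j) (x (s n))) \<longlonglongrightarrow> 0" if "j \<in> {1..r}" for j
    by (rule Lim_null_comparison[rotated], intro always_eventually allI)
      (rule cut_depth_le_dist_later_iterate[OF it F_ne _ that], use s in \<open>simp add: strict_mono_def\<close>)
  then have proj_lim: "(\<lambda>n. closest_point (K j) (x (s n))) \<longlonglongrightarrow> L" if "j \<in> {1..r}" for j
    using tendsto_diff[OF lim] that by fastforce
  have "L \<in> K j" if j: "j \<in> {1..r}" for j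
  proof (rule closed_sequentially[OF closed[OF j] _ proj_lim[OF j]])
    have "K j \<noteq> {}" using ne j by blast
    then show "closest_point (K j) (x (s n)) \<in> K j" for n
      by (rule closest_point_in_set[OF closed[OF j]])
  qed
  then have "L \<in> C" by (auto simp: C_def)
  moreover have "dist x0 L \<le> dist x0 y" if "y \<in> C" for y
    using tendsto_dist[OF tendsto_const lim] by (rule LIMSEQ_le_const2) (use le that in blast)
  ultimately have "L = closest_point C x0"
    using C by (intro closest_point_unique) auto
  then show thesis using that s lim by (simp add: C_def)
qed

theorem theorem3p5:
  fixes K :: "nat \<Rightarrow> (real ^ 'n) set" and r :: nat
    and x0 xbar :: "real ^ 'n" and x :: "nat \<Rightarrow> real ^ 'n" and eps :: real
  assumes "\<And>j. j \<in> {1..r} \<Longrightarrow> closed (K j)"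
    and "\<And>j. j \<in> {1..r} \<Longrightarrow> convex (K j)"
    and "(\<Inter>j\<in>{1..r}. K j) \<noteq> {}"
    and "xbar = closest_point (\<Inter>j\<in>{1..r}. K j) x0"
    and "eps > 0"
    and "\<And>j. j \<in> {1..r} \<Longrightarrow>
           (\<lambda>y. y - xbar) ` K j \<inter> cball 0 eps = tangent_cone (K j) xbar \<inter> cball 0 eps"
    and "x0 - xbar \<in> interior (normal_cone (\<Inter>j\<in>{1..r}. K j) xbar)"
    and "best_approx_iterates K r x0 x"
  shows "\<exists>i. x i = xbar"
proof (rule ccontr)
  assume "\<not> ?thesis"
  then have neq: "x i \<noteq> xbar" for i by blast
  note it = assms(8)
  define C where "C = (\<Inter>j\<in>{1..r}. K j)"
  have C: "closed C" "C \<noteq> {}"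
    using assms(1,3) by (auto simp: C_def)
  have xbar: "xbar \<in> C"
    unfolding assms(4) C_def[symmetric] by (rule closest_point_in_set[OF C])
  have xbar_F: "xbar \<in> outer_polyhedron K r x i" for i
    using Inter_subset_outer_polyhedron[of r K, OF assms(1,2)] xbar unfolding C_def by (rule subsetD)

  define D where "D i = inverse (norm (x i - xbar)) *\<^sub>R (x i - xbar)" for i
  have D_norm: "norm (D i) = 1" for i using neq by (simp add: D_def)

  obtain s where s: "strict_mono s" and lim_s: "(\<lambda>n. x (s n)) \<longlonglongrightarrow> xbar"
    unfolding assms(4) by (rule iterates_cluster_at_projection[of r K x0 x, OF assms(1-3) it])
  have "\<forall>n. (D \<circ> s) n \<in> sphere 0 1" using D_norm by simp
  then obtain d t where d: "d \<in> sphere 0 1" and t: "strict_mono t"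
    and lim_t: "((D \<circ> s) \<circ> t) \<longlonglongrightarrow> d"
    using compact_sphere unfolding compact_def by meson
  define q where "q = s \<circ> t"
  have q: "strict_mono q" unfolding q_def by (intro strict_mono_o s t)
  have lim_x: "(\<lambda>n. x (q n)) \<longlonglongrightarrow> xbar"
    using LIMSEQ_subseq_LIMSEQ[OF lim_s t] by (simp add: q_def o_def)
  have lim_D: "(\<lambda>n. D (q n)) \<longlonglongrightarrow> d"
    using lim_t by (simp add: q_def o_def)

  have "d \<in> tangent_cone (K j) xbar" if j: "j \<in> {1..r}" for j
  proof -
    define T where "T = tangent_cone (K j) xbar"
    have xbar_j: "xbar \<in> K j" using xbar j by (auto simp: C_def)
    have T: "closed T" "convex T" "cone T" "T \<noteq> {}"
      using closed_tangent_cone convex_tangent_cone assms(2)[OF j] cone_tangent_cone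
        diff_in_tangent_cone[OF xbar_j, of xbar] by (auto simp: T_def)
    define R where "R v = v - closest_point T v" for v
    have lim_R: "(\<lambda>n. R (D (q n))) \<longlonglongrightarrow> R d"
      unfolding R_def using lim_D T
      by (intro tendsto_diff isCont_tendsto_compose[OF continuous_at_closest_point])
    have "\<forall>\<^sub>F n in sequentially. norm (x (q n) - xbar) < eps"
      using tendstoD[OF lim_x \<open>eps > 0\<close>] by (simp add: dist_norm)
    moreover have "R (D (q n)) \<bullet> d \<le> 0" if near: "norm (x (q n) - xbar) < eps" for n
    proof -
      define v where "v = x (q n) - xbar"
      have proj: "closest_point (K j) (x (q n)) = xbar + closest_point T v"
        unfolding T_def v_def using assms(1,2,6)[OF j] xbar_j near
        by (intro closest_point_locally_conic) auto
      have R_D: "R (D (q n)) = inverse (norm v) *\<^sub>R R v"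
        using closest_point_cone_scaleR[OF T, of "inverse (norm v)" v] neq[of "q n"]
        by (simp add: R_def D_def v_def scaleR_diff_right)
      have "R (D (q n)) \<bullet> D (q m) \<le> 0" if "n < m" for m
      proof -
        have "q n < q m" using q that by (simp add: strict_mono_def)
        then have "(x (q n) - closest_point (K j) (x (q n)))
            \<bullet> (x (q m) - closest_point (K j) (x (q n))) \<le> 0"
          using xbar_F j by (intro iterate_satisfies_earlier_cuts[OF it]) auto
        then have "R v \<bullet> (x (q m) - xbar) - R v \<bullet> closest_point T v \<le> 0"
          by (simp add: proj R_def v_def inner_diff_right inner_diff_left inner_add_right
              inner_add_left algebra_simps)
        \<comment> \<open>By orthogonality the hyperplane of the cut passes through \<open>xbar\<close>.\<close>
        then have "R v \<bullet> (x (q m) - xbar) \<le> 0"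
          using closest_point_cone_orthogonal[OF T, of v] by (simp add: R_def)
        then show ?thesis
          unfolding R_D by (simp add: D_def mult_nonneg_nonpos)
      qed
      then have "\<forall>m\<ge>Suc n. R (D (q n)) \<bullet> D (q m) \<le> 0" by auto
      then show ?thesis
        by (intro LIMSEQ_le_const2[OF tendsto_inner[OF tendsto_const lim_D]]) blast
    qed
    ultimately have "\<forall>\<^sub>F n in sequentially. R (D (q n)) \<bullet> d \<le> 0"
      by (auto elim: eventually_mono)
    then have "R d \<bullet> d \<le> 0"
      by (intro tendsto_upperbound[OF tendsto_inner[OF lim_R tendsto_const]]) auto
    then have "R d \<bullet> R d \<le> 0"
      using closest_point_cone_orthogonal[OF T, of d] by (simp add: R_def inner_diff_right)
    then have "R d = 0" using inner_gt_zero_iff[of "R d"] by fastforce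
    then have "d = closest_point T d" by (simp add: R_def)
    then show ?thesis
      using closest_point_in_set[OF T(1,4), of d] by (simp add: T_def)
  qed
  then have "eps *\<^sub>R d \<in> tangent_cone (K j) xbar \<inter> cball 0 eps" if "j \<in> {1..r}" for j
    using that d \<open>eps > 0\<close> by (auto intro!: mem_cone cone_tangent_cone)
  then have "eps *\<^sub>R d \<in> (\<lambda>y. y - xbar) ` K j" if "j \<in> {1..r}" for j
    using that assms(6)[OF that] by blast
  then have "xbar + eps *\<^sub>R d \<in> C"
    by (force simp: C_def)
  then have "(x0 - xbar) \<bullet> (xbar + eps *\<^sub>R d - xbar) < 0"
    using assms(7) d \<open>eps > 0\<close> by (intro interior_normal_cone_dot_less) (auto simp: C_def)
  then have "(x0 - xbar) \<bullet> d < 0"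
    using \<open>eps > 0\<close> by (simp add: mult_less_0_iff)
  moreover have "(x0 - xbar) \<bullet> d \<ge> 0"
  proof (rule LIMSEQ_le_const)
    show "(\<lambda>n. (x0 - x (q n)) \<bullet> D (q n)) \<longlonglongrightarrow> (x0 - xbar) \<bullet> d"
      by (intro tendsto_inner tendsto_diff tendsto_const lim_x lim_D)
    have "(x0 - x i) \<bullet> D i \<ge> 0" for i
    proof -
      have "(x0 - x i) \<bullet> (xbar - x i) \<le> 0"
        unfolding iterate_eq_closest_point[OF it, of i]
        by (intro closest_point_dot convex_outer_polyhedron closed_outer_polyhedron xbar_F)
      then have "(x0 - x i) \<bullet> (x i - xbar) \<ge> 0"
        by (simp add: inner_diff_right)
      then show ?thesis by (simp add: D_def)
    qed
    then show "\<exists>N. \<forall>n\<ge>N. 0 \<le> (x0 - x (q n)) \<bullet> D (q n)" by blast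
  qed
  ultimately show False by simp
qed

end
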